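(* Let $\mathbb{H}$ be a complex Hilbert space and let $A\in\mathbb{B}(\mathbb{H})$. Then \[\omega(A)=\sup_{\theta\in\mathbb{R}}\int_0^1\omega\big((1-t)e^{i\theta}A+te^{-i\theta}A^*\big)\,dt.\] In particular, if $A$ is a normal operator, then \[\|A\|=\sup_{\theta\in\mathbb{R}}\int_0^1\omega\big((1-t)e^{i\theta}A+te^{-i\theta}A^*\big)\,dt.\]
   Context: $\mathbb{B}(\mathbb{H})$ denotes the $C^*$-algebra of all bounded linear operators on $\mathbb{H}$, $\|\cdot\|$ is the operator norm, and $A^*$ is the adjoint of $A$. The numerical radius of an operator $X$ on a complex Hilbert space is $\omega(X)=\sup_{\|x\|=1}|\langle Xx,x\rangle|$. *)

theory Defs
  imports "HOL-Analysis.Analysis"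
begin

(* The real vector space structure, norm and topology are inherited from real_normed_vector;
   the axioms scaleR_scaleC and norm_eq_sqrt_cinner tie them to the complex structure.
   The inner product is linear in its first argument. *)
class complex_inner = real_normed_vector +
  fixes scaleC :: "complex \<Rightarrow> 'a \<Rightarrow> 'a"  (infixr "*\<^sub>C" 75)
    and cinner :: "'a \<Rightarrow> 'a \<Rightarrow> complex"
  assumes scaleC_add_right: "a *\<^sub>C (x + y) = a *\<^sub>C x + a *\<^sub>C y"
    and scaleC_add_left: "(a + b) *\<^sub>C x = a *\<^sub>C x + b *\<^sub>C x"
    and scaleC_scaleC: "a *\<^sub>C b *\<^sub>C x = (a * b) *\<^sub>C x"
    and scaleC_one: "1 *\<^sub>C x = x"
    and scaleR_scaleC: "r *\<^sub>R x = complex_of_real r *\<^sub>C x"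
    and cinner_commute: "cinner x y = cnj (cinner y x)"
    and cinner_add_left: "cinner (x + y) z = cinner x z + cinner y z"
    and cinner_scaleC_left: "cinner (a *\<^sub>C x) y = a * cinner x y"
    and cinner_self_nonneg: "0 \<le> Re (cinner x x)"
    and cinner_eq_zero_iff: "cinner x x = 0 \<longleftrightarrow> x = 0"
    and norm_eq_sqrt_cinner: "norm x = sqrt (Re (cinner x x))"

class chilbert_space = complex_inner + complete_space

instantiation complex :: chilbert_space
begin

definition scaleC_complex :: "complex \<Rightarrow> complex \<Rightarrow> complex" where
  "scaleC_complex a x = a * x"

definition cinner_complex :: "complex \<Rightarrow> complex \<Rightarrow> complex" where
  "cinner_complex x y = x * cnj y"

instance
  by standard
    (auto simp: scaleC_complex_def cinner_complex_def algebra_simps scaleR_conv_of_real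
      cmod_def power2_eq_square)

end

(* The elements of B(H). *)
definition bounded_clinear :: "('a::complex_inner \<Rightarrow> 'a) \<Rightarrow> bool" where
  "bounded_clinear A \<longleftrightarrow> bounded_linear A \<and> (\<forall>c x. A (c *\<^sub>C x) = c *\<^sub>C A x)"

(* For a bounded operator on a Hilbert space such a B exists (Riesz representation) and is
   unique; for other arguments the value is unspecified. *)
definition cadjoint :: "('a::chilbert_space \<Rightarrow> 'a) \<Rightarrow> 'a \<Rightarrow> 'a" where
  "cadjoint A = (THE B. \<forall>x y. cinner (A x) y = cinner x (B y))"

definition normal_operator :: "('a::chilbert_space \<Rightarrow> 'a) \<Rightarrow> bool" where
  "normal_operator A \<longleftrightarrow> bounded_clinear A \<and> A \<circ> cadjoint A = cadjoint A \<circ> A"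

(* The supremum is taken in [0, infinity): inserting 0 only matters on the zero space, where
   there are no unit vectors and Sup {} on the reals would be an unspecified number. *)
definition numerical_radius :: "('a::complex_inner \<Rightarrow> 'a) \<Rightarrow> real" where
  "numerical_radius X = Sup (insert 0 {cmod (cinner (X x) x) | x. norm x = 1})"

end

theory Submission imports Defs begin

text \<open>Put \<open>z = e\<^sup>i\<^sup>\<theta>\<langle>Ax, x\<rangle>\<close>. The quadratic form of the integrand at \<open>x\<close> is
  \<open>(1 - t) z + t cnj z = Re z + \<i> (1 - 2t) Im z\<close>, whose modulus is at most \<open>\<bar>z\<bar>\<close>, with equality for
  all \<open>t\<close> when \<open>\<theta>\<close> rotates \<open>\<langle>Ax, x\<rangle>\<close> onto the positive half-line. This gives both inequalities.

  For normal \<open>A\<close>, \<open>\<parallel>Ax\<parallel>\<^sup>2 \<le> \<parallel>A\<^sup>2x\<parallel> \<parallel>x\<parallel>\<close> and \<open>\<omega>(A\<^sup>2) \<le> \<omega>(A)\<^sup>2\<close>, so a bound \<open>\<parallel>A\<parallel> \<le> c \<omega>(A)\<close> valid for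
  all normal operators improves to \<open>\<parallel>A\<parallel> \<le> \<surd>c \<omega>(A)\<close>. Polarization provides \<open>c = 2\<close>, and iterating
  drives \<open>c\<close> down to \<open>1\<close>.\<close>

section \<open>Complex inner product spaces\<close>

lemma cinner_add_right: "cinner x (y + z) = cinner x y + cinner x z"
  by (metis cinner_add_left cinner_commute complex_cnj_add)

lemma cinner_scaleC_right: "cinner x (a *\<^sub>C y) = cnj a * cinner x y"
  by (metis cinner_scaleC_left cinner_commute complex_cnj_mult)

lemma cinner_zero_left [simp]: "cinner 0 x = 0"
  using cinner_add_left[of 0 0 x] by simp

lemma cinner_zero_right [simp]: "cinner x 0 = 0"
  using cinner_add_right[of x 0 0] by simp

lemma cinner_minus_left: "cinner (- x) y = - cinner x y"
  using cinner_add_left[of x "- x" y] by (simp add: eq_neg_iff_add_eq_0 add.commute)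

lemma cinner_minus_right: "cinner x (- y) = - cinner x y"
  using cinner_add_right[of x y "- y"] by (simp add: eq_neg_iff_add_eq_0 add.commute)

lemma cinner_diff_left: "cinner (x - y) z = cinner x z - cinner y z"
  using cinner_add_left[of x "- y" z] by (simp add: cinner_minus_left)

lemma cinner_diff_right: "cinner x (y - z) = cinner x y - cinner x z"
  using cinner_add_right[of x y "- z"] by (simp add: cinner_minus_right)

lemma cinner_scaleR_left: "cinner (r *\<^sub>R x) y = of_real r * cinner x y"
  by (simp add: scaleR_scaleC cinner_scaleC_left)

lemma cinner_scaleR_right: "cinner x (r *\<^sub>R y) = of_real r * cinner x y"
  by (simp add: scaleR_scaleC cinner_scaleC_right)

lemmas cinner_linear_simps = cinner_add_left cinner_add_right cinner_diff_left cinner_diff_right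
  cinner_scaleC_left cinner_scaleC_right cinner_scaleR_left cinner_scaleR_right

lemma Re_cinner_self: "Re (cinner x x) = (norm x)\<^sup>2"
  by (simp add: norm_eq_sqrt_cinner cinner_self_nonneg)

lemma cinner_self: "cinner x x = of_real ((norm x)\<^sup>2)"
proof -
  have "Im (cinner x x) = 0"
    using cinner_commute[of x x] by (metis cnj.sel(2) eq_neg_iff_add_eq_0 double_zero)
  then show ?thesis
    by (simp add: complex_eq_iff Re_cinner_self)
qed

lemma norm_add_sq: "(norm (x + y))\<^sup>2 = (norm x)\<^sup>2 + 2 * Re (cinner x y) + (norm y)\<^sup>2"
proof -
  have "Re (cinner y x) = Re (cinner x y)"
    by (subst cinner_commute) simp
  then show ?thesis
    by (simp add: cinner_linear_simps flip: Re_cinner_self)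
qed

lemma norm_diff_sq: "(norm (x - y))\<^sup>2 = (norm x)\<^sup>2 - 2 * Re (cinner x y) + (norm y)\<^sup>2"
  using norm_add_sq[of x "- y"] by (simp add: cinner_minus_right)

lemma norm_scaleC: "norm (a *\<^sub>C x) = cmod a * norm x"
proof -
  have "(norm (a *\<^sub>C x))\<^sup>2 = Re (a * cnj a * cinner x x)"
    by (simp only: Re_cinner_self[symmetric] cinner_linear_simps mult_ac)
  also have "\<dots> = (cmod a * norm x)\<^sup>2"
    by (simp add: cinner_self complex_mult_cnj cmod_power2 power_mult_distrib
        flip: of_real_mult of_real_add of_real_power)
  finally show ?thesis
    by (simp add: power2_eq_iff_nonneg)
qed

text \<open>Take \<theta> to be minus the argument of \<open>a\<close>. Rotations of this kind later
  turn bounds on real parts into bounds on moduli.\<close>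

lemma ex_rotation: "\<exists>\<theta>::real. exp (\<i> * of_real \<theta>) * a = of_real (cmod a)"
proof -
  have "exp (\<i> * of_real (- Arg a)) * a
      = exp (\<i> * of_real (- Arg a)) * (of_real (cmod a) * exp (\<i> * of_real (Arg a)))"
    by (metis Arg_zero Arg_eq mult_zero_left norm_zero of_real_0)
  also have "\<dots> = of_real (cmod a)"
    by (simp add: exp_minus)
  finally show ?thesis ..
qed

text \<open>The triangle inequality comes with the class \<open>real_normed_vector\<close>, so it
  can serve as the source: rotate \<open>x\<close> until the inner product equals its modulus, then
  compare the expansions of \<open>(norm (u + y))\<^sup>2\<close> and
  \<open>(norm u + norm y)\<^sup>2\<close>.\<close>

lemma cinner_Cauchy_Schwarz: "cmod (cinner x y) \<le> norm x * norm y"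
proof -
  obtain \<theta> :: real where \<theta>: "exp (\<i> * of_real \<theta>) * cinner x y = of_real (cmod (cinner x y))"
    using ex_rotation by blast
  define u where "u = exp (\<i> * of_real \<theta>) *\<^sub>C x"
  have u: "norm u = norm x"
    by (simp add: u_def norm_scaleC)
  have "cinner u y = of_real (cmod (cinner x y))"
    by (simp add: u_def cinner_linear_simps \<theta>)
  then have "(norm (u + y))\<^sup>2 = (norm u)\<^sup>2 + 2 * cmod (cinner x y) + (norm y)\<^sup>2"
    by (simp add: norm_add_sq)
  moreover have "(norm (u + y))\<^sup>2 \<le> (norm u + norm y)\<^sup>2"
    by (intro power_mono norm_triangle_ineq) simp
  ultimately show ?thesis
    by (simp add: power2_sum u)
qed

section \<open>Riesz representation and the adjoint\<close>

text \<open>The representing vector is the minimizer of \<open>\<parallel>x\<parallel>\<^sup>2 - 2 Re (f x)\<close>; the parallelogram law makes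
  minimizing sequences Cauchy.\<close>

lemma riesz_representation:
  fixes f :: "'a::chilbert_space \<Rightarrow> complex"
  assumes add: "\<And>x y. f (x + y) = f x + f y"
    and scale: "\<And>c x. f (c *\<^sub>C x) = c * f x"
    and bound: "\<And>x. cmod (f x) \<le> K * norm x"
  shows "\<exists>y. \<forall>x. f x = cinner x y"
proof -
  have scaleR: "f (r *\<^sub>R x) = of_real r * f x" for r x
    by (simp add: scaleR_scaleC scale)
  define J where "J x = (norm x)\<^sup>2 - 2 * Re (f x)" for x
  have below: "- K\<^sup>2 \<le> J x" for x
  proof -
    have "Re (f x) \<le> K * norm x"
      using bound[of x] complex_Re_le_cmod[of "f x"] by linarith
    moreover have "0 \<le> (norm x - K)\<^sup>2"
      by simp
    ultimately show ?thesis
      by (simp add: J_def power2_diff mult.commute)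
  qed
  define m where "m = Inf (range J)"
  have bdd: "bdd_below (range J)"
    using below by (intro bdd_belowI[of _ "- K\<^sup>2"]) auto
  have m_le: "m \<le> J x" for x
    unfolding m_def by (rule cInf_lower[OF _ bdd]) simp
  have "\<exists>x. J x < m + inverse (real (Suc n))" for n
    using cInf_lessD[of "range J" "m + inverse (real (Suc n))"] by (auto simp: m_def)
  then obtain u where u: "\<And>n. J (u n) < m + inverse (real (Suc n))"
    by metis
  have para: "(dist x y)\<^sup>2 \<le> 2 * (J x - m) + 2 * (J y - m)" for x y
  proof -
    have "4 * J ((1/2) *\<^sub>R (x + y)) = (norm (x + y))\<^sup>2 - 4 * Re (f x) - 4 * Re (f y)"
      by (simp add: J_def scaleR add power_mult_distrib power_divide del: scaleR_add_right) argo
    then have "(norm (x - y))\<^sup>2 = 2 * J x + 2 * J y - 4 * J ((1/2) *\<^sub>R (x + y))"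
      by (simp add: J_def norm_add_sq norm_diff_sq)
    then show ?thesis
      using m_le[of "(1/2) *\<^sub>R (x + y)"] by (simp add: dist_norm)
  qed
  have "Cauchy u"
  proof (rule metric_CauchyI)
    fix e :: real assume "0 < e"
    then obtain N where N: "inverse (real (Suc N)) < e\<^sup>2 / 4"
      using reals_Archimedean[of "e\<^sup>2 / 4"] by auto
    have close: "J (u n) - m < e\<^sup>2 / 4" if "N \<le> n" for n
    proof -
      have "inverse (real (Suc n)) \<le> inverse (real (Suc N))"
        using that by (intro le_imp_inverse_le) auto
      then show ?thesis
        using u[of n] N by linarith
    qed
    have "dist (u p) (u q) < e" if "N \<le> p" "N \<le> q" for p q
    proof -
      have "(dist (u p) (u q))\<^sup>2 < 2 * (e\<^sup>2 / 4) + 2 * (e\<^sup>2 / 4)"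
        using para[of "u p" "u q"] close[OF that(1)] close[OF that(2)] by argo
      then have "(dist (u p) (u q))\<^sup>2 < e\<^sup>2"
        by argo
      then show ?thesis
        using \<open>0 < e\<close> by (simp add: power_less_imp_less_base)
    qed
    then show "\<exists>N. \<forall>p\<ge>N. \<forall>q\<ge>N. dist (u p) (u q) < e"
      by blast
  qed
  then obtain y where y: "u \<longlonglongrightarrow> y"
    using Cauchy_convergent_iff convergent_def by blast
  have "bounded_linear f"
    by (rule bounded_linear_intro[where K = K])
      (auto simp: add scaleR scaleR_conv_of_real bound mult.commute)
  then have "(\<lambda>n. f (u n)) \<longlonglongrightarrow> f y"
    using y by (rule bounded_linear.tendsto)
  with y have "(\<lambda>n. J (u n)) \<longlonglongrightarrow> J y"
    unfolding J_def by (intro tendsto_intros)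
  moreover have "(\<lambda>n. m + inverse (real (Suc n))) \<longlonglongrightarrow> m + 0"
    by (intro tendsto_intros LIMSEQ_inverse_real_of_nat)
  ultimately have "J y \<le> m + 0"
    by (rule LIMSEQ_le) (use u less_imp_le in blast)
  then have min: "J y \<le> J x" for x
    using m_le[of x] by simp
  \<comment> \<open>First-order condition at the minimizer: along the line
    \<open>t *\<^sub>R h + y\<close> the increment of \<open>J\<close> is a nonnegative quadratic in
    \<open>t\<close> without constant term, so its linear coefficient \<open>2 * d\<close> must
    vanish.\<close>
  have Re_eq: "Re (f h) = Re (cinner h y)" for h
  proof -
    define d where "d = Re (cinner h y) - Re (f h)"
    have quad: "0 \<le> 2 * t * d + t\<^sup>2 * (norm h)\<^sup>2" for t :: real
    proof -
      have "J (t *\<^sub>R h + y) = J y + 2 * t * d + t\<^sup>2 * (norm h)\<^sup>2"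
        unfolding J_def norm_add_sq add scaleR cinner_linear_simps d_def
        by (simp add: power_mult_distrib algebra_simps)
      then show ?thesis
        using min[of "t *\<^sub>R h + y"] by simp
    qed
    \<comment> \<open>At \<open>t = - s * d\<close> the quadratic equals
      \<open>s * d\<^sup>2 * (s * (norm h)\<^sup>2 - 2)\<close>, which is negative unless
      \<open>d = 0\<close>. The summand 1 keeps \<open>s\<close> well-defined for
      \<open>h = 0\<close>.\<close>
    define s where "s = inverse ((norm h)\<^sup>2 + 1)"
    have s: "0 < s" "s * (norm h)\<^sup>2 < 1"
      by (auto simp: s_def field_simps add_pos_nonneg add_nonneg_pos)
    have "0 \<le> s * d\<^sup>2 * (s * (norm h)\<^sup>2 - 2)"
      using quad[of "- s * d"] by (simp add: power2_eq_square algebra_simps)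
    then have "s * d\<^sup>2 \<le> 0"
      using s(2) by (smt (verit) mult_neg_pos mult.commute)
    then have "d = 0"
      using s(1) by (simp add: mult_le_0_iff)
    then show ?thesis
      by (simp add: d_def)
  qed
  \<comment> \<open>The imaginary parts agree because Im a = - Re (i a), with \<open>Re_eq\<close>
    applied to i times \<open>x\<close>.\<close>
  have "f x = cinner x y" for x
    using Re_eq[of x] Re_eq[of "\<i> *\<^sub>C x"]
    by (simp add: scale cinner_linear_simps complex_eq_iff)
  then show ?thesis
    by blast
qed

lemma bounded_clinear_bounded_linear: "bounded_clinear A \<Longrightarrow> bounded_linear A"
  by (simp add: bounded_clinear_def)

text \<open>This discharges the \<open>THE\<close> in \<open>cadjoint\<close>. Existence is Riesz
  representation of \<open>cinner (A x) y\<close> as a functional of \<open>x\<close>; uniqueness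
  follows by pairing the difference of two candidates with itself.\<close>

lemma cinner_cadjoint:
  fixes A :: "'a::chilbert_space \<Rightarrow> 'a"
  assumes "bounded_clinear A"
  shows "cinner (A x) y = cinner x (cadjoint A y)"
proof -
  interpret A: bounded_linear A
    using assms by (rule bounded_clinear_bounded_linear)
  have "\<exists>z. \<forall>x. cinner (A x) y = cinner x z" for y
  proof (rule riesz_representation)
    show "cmod (cinner (A x) y) \<le> (onorm A * norm y) * norm x" for x
    proof -
      have "cmod (cinner (A x) y) \<le> norm (A x) * norm y"
        by (rule cinner_Cauchy_Schwarz)
      also have "\<dots> \<le> (onorm A * norm x) * norm y"
        by (intro mult_right_mono onorm A.bounded_linear_axioms) simp
      finally show ?thesis
        by (simp add: mult_ac)
    qed
  qed (use assms in \<open>auto simp: A.add bounded_clinear_def cinner_linear_simps\<close>)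
  then obtain B where B: "\<forall>x y. cinner (A x) y = cinner x (B y)"
    by metis
  have "C = B" if "\<forall>x y. cinner (A x) y = cinner x (C y)" for C
  proof
    fix y
    have "cinner (C y - B y) (C y - B y) = 0"
      by (metis B that cinner_diff_right eq_iff_diff_eq_0)
    then show "C y = B y"
      by (simp add: cinner_eq_zero_iff)
  qed
  with B have "\<forall>x y. cinner (A x) y = cinner x (cadjoint A y)"
    unfolding cadjoint_def by (rule theI[where P = "\<lambda>B. \<forall>x y. cinner (A x) y = cinner x (B y)"])
  then show ?thesis
    by blast
qed

section \<open>Numerical radius\<close>

lemma numerical_radius_le:
  assumes "0 \<le> c" "\<And>x. norm x = 1 \<Longrightarrow> cmod (cinner (X x) x) \<le> c"
  shows "numerical_radius X \<le> c"
  unfolding numerical_radius_def using assms by (intro cSup_least) auto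

text \<open>The bound \<open>K\<close> makes the real \<open>Sup\<close> a genuine supremum. Since
  \<open>X\<close> is an arbitrary function, the lemma applies directly to the operators under the
  integral, given only a bound on their forms.\<close>

lemma numerical_radius_ge:
  assumes "\<And>x. norm x = 1 \<Longrightarrow> cmod (cinner (X x) x) \<le> K"
  shows "norm x = 1 \<Longrightarrow> cmod (cinner (X x) x) \<le> numerical_radius X"
    and "0 \<le> numerical_radius X"
proof -
  have "bdd_above (insert 0 {cmod (cinner (X x) x) | x. norm x = 1})"
    using assms unfolding bdd_above_insert by (intro bdd_aboveI[of _ K]) auto
  then show "norm x = 1 \<Longrightarrow> cmod (cinner (X x) x) \<le> numerical_radius X"
    and "0 \<le> numerical_radius X"
    unfolding numerical_radius_def by (auto intro!: cSup_upper)
qed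

lemma cmod_cinner_le_onorm:
  assumes "bounded_linear A" "norm x = 1"
  shows "cmod (cinner (A x) x) \<le> onorm A"
  using cinner_Cauchy_Schwarz[of "A x" x] onorm[OF assms(1), of x] assms(2) by simp

lemma numerical_radius_upper:
  assumes "bounded_linear A" "norm x = 1"
  shows "cmod (cinner (A x) x) \<le> numerical_radius A"
  using cmod_cinner_le_onorm[OF assms(1)] assms(2) by (rule numerical_radius_ge(1))

lemma numerical_radius_nonneg: "bounded_linear A \<Longrightarrow> 0 \<le> numerical_radius A"
  using cmod_cinner_le_onorm by (rule numerical_radius_ge(2))

lemma cmod_cinner_le_numerical_radius:
  assumes "bounded_linear A"
  shows "cmod (cinner (A x) x) \<le> numerical_radius A * (norm x)\<^sup>2"
proof (cases "x = 0")
  case False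
  interpret A: bounded_linear A by fact
  define u where "u = (1 / norm x) *\<^sub>R x"
  have x: "x = norm x *\<^sub>R u" and u: "norm u = 1"
    using False by (auto simp: u_def)
  have "cinner (A x) x = of_real ((norm x)\<^sup>2) * cinner (A u) u"
    by (subst (1 2) x) (simp add: A.scaleR cinner_linear_simps power2_eq_square)
  then have "cmod (cinner (A x) x) = (norm x)\<^sup>2 * cmod (cinner (A u) u)"
    by (simp add: norm_mult norm_power)
  then show ?thesis
    using mult_left_mono[OF numerical_radius_upper[OF assms u], of "(norm x)\<^sup>2"]
    by (simp add: mult.commute)
qed simp

section \<open>Normal operators\<close>

text \<open>Polarization writes \<open>4 * cinner (A x) y\<close> through four values of the
  quadratic form. For unit vectors two parallelogram laws make the squared norms add up to 8, and 8
  / 4 is the constant 2. Taking \<open>y\<close> parallel to \<open>A x\<close> then bounds the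
  norm.\<close>

lemma norm_le_twice_form_bound:
  assumes "bounded_clinear A" and w: "\<And>x. cmod (cinner (A x) x) \<le> w * (norm x)\<^sup>2"
  shows "norm (A x) \<le> 2 * w * norm x"
proof -
  interpret A: bounded_linear A
    using assms(1) by (rule bounded_clinear_bounded_linear)
  have AC: "A (c *\<^sub>C x) = c *\<^sub>C A x" for c x
    using assms(1) by (simp add: bounded_clinear_def)
  have unit: "cmod (cinner (A x) y) \<le> 2 * w" if "norm x = 1" "norm y = 1" for x y
  proof -
    define q where "q v = cinner (A v) v" for v
    have "4 * cinner (A x) y = q (x + y) - q (x - y) + \<i> * q (x + \<i> *\<^sub>C y) - \<i> * q (x - \<i> *\<^sub>C y)"
      by (simp add: q_def A.add A.diff AC cinner_linear_simps algebra_simps)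
    then have "4 * cmod (cinner (A x) y)
        = cmod (q (x + y) - q (x - y) + \<i> * q (x + \<i> *\<^sub>C y) - \<i> * q (x - \<i> *\<^sub>C y))"
      by (metis norm_mult norm_numeral)
    also have "\<dots> \<le> cmod (q (x + y)) + cmod (q (x - y)) + cmod (\<i> * q (x + \<i> *\<^sub>C y))
        + cmod (\<i> * q (x - \<i> *\<^sub>C y))"
      by (smt (verit) norm_triangle_ineq norm_triangle_ineq4)
    also have "\<dots> \<le> w * (norm (x + y))\<^sup>2 + w * (norm (x - y))\<^sup>2 + w * (norm (x + \<i> *\<^sub>C y))\<^sup>2
        + w * (norm (x - \<i> *\<^sub>C y))\<^sup>2"
      unfolding q_def norm_mult by (intro add_mono) (simp_all add: w)
    also have "\<dots> = 8 * w"
      by (simp add: norm_add_sq norm_diff_sq norm_scaleC that algebra_simps)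
    finally show ?thesis
      by simp
  qed
  show ?thesis
  proof (cases "x = 0 \<or> A x = 0")
    case True
    show ?thesis
    proof (cases "x = 0")
      case False
      \<comment> \<open>Nonnegativity of \<open>w\<close> is read off from the form bound at the
        nonzero vector \<open>x\<close>.\<close>
      have "0 \<le> w * (norm x)\<^sup>2"
        using order_trans[OF norm_ge_zero w] .
      then have "0 \<le> w"
        using False by (simp add: zero_le_mult_iff)
      then show ?thesis
        using True False by simp
    qed (simp add: A.zero)
  next
    case False
    define u v where "u = (1 / norm x) *\<^sub>R x" and "v = (1 / norm (A x)) *\<^sub>R A x"
    have "norm u = 1" "norm v = 1"
      using False by (auto simp: u_def v_def)
    then have "cmod (cinner (A u) v) \<le> 2 * w"
      by (rule unit)
    moreover have "cinner (A u) v = of_real (norm (A x) / norm x)"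
      using False
      by (simp add: u_def v_def A.scaleR cinner_linear_simps cinner_self power2_eq_square field_simps)
    ultimately have "norm (A x) / norm x \<le> 2 * w"
      by (simp add: norm_divide)
    then show ?thesis
      using False by (simp add: divide_le_eq)
  qed
qed

text \<open>Pearcy's argument for the power inequality: with \<open>u = (w + A) x\<close> and \<open>v = (w - A) x\<close>,
  \<open>2 w \<langle>(w\<^sup>2 - A\<^sup>2) x, x\<rangle> = \<langle>(w - A) u, u\<rangle> + \<langle>(w + A) v, v\<rangle>\<close>, and the right-hand side has nonnegative
  real part.\<close>

lemma form_bound_square_Re:
  assumes "bounded_clinear A" and "0 < w"
    and w: "\<And>x. cmod (cinner (A x) x) \<le> w * (norm x)\<^sup>2"
  shows "Re (cinner (A (A x)) x) \<le> w\<^sup>2 * (norm x)\<^sup>2"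
proof -
  interpret A: bounded_linear A
    using assms(1) by (rule bounded_clinear_bounded_linear)
  define u v where "u = w *\<^sub>R x + A x" and "v = w *\<^sub>R x - A x"
  have "0 \<le> Re (cinner (w *\<^sub>R u - A u) u)"
    using w[of u] complex_Re_le_cmod[of "cinner (A u) u"]
    by (simp add: cinner_linear_simps Re_cinner_self)
  moreover have "0 \<le> Re (cinner (w *\<^sub>R v + A v) v)"
    using w[of v] abs_Re_le_cmod[of "cinner (A v) v"]
    by (simp add: cinner_linear_simps Re_cinner_self)
  moreover have "cinner (w *\<^sub>R u - A u) u + cinner (w *\<^sub>R v + A v) v
      = of_real (2 * w) * (of_real (w\<^sup>2) * cinner x x - cinner (A (A x)) x)"
    by (simp add: u_def v_def A.add A.diff A.scaleR cinner_linear_simps algebra_simps power2_eq_square)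
  ultimately have "0 \<le> Re (of_real (2 * w) * (of_real (w\<^sup>2) * cinner x x - cinner (A (A x)) x))"
    by (metis add_nonneg_nonneg plus_complex.sel(1))
  also have "\<dots> = 2 * w * (w\<^sup>2 * (norm x)\<^sup>2 - Re (cinner (A (A x)) x))"
    by (simp add: Re_cinner_self del: of_real_power of_real_mult)
  finally show ?thesis
    using \<open>0 < w\<close> by (simp add: zero_le_mult_iff)
qed

lemma scaleC_bounded_clinear:
  assumes "bounded_clinear A"
  shows "bounded_clinear (\<lambda>x. c *\<^sub>C A x)"
proof -
  interpret A: bounded_linear A
    using assms by (rule bounded_clinear_bounded_linear)
  have "bounded_linear (\<lambda>x. c *\<^sub>C A x)"
  proof (rule bounded_linear_intro)
    show "norm (c *\<^sub>C A x) \<le> norm x * (onorm A * cmod c)" for x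
      using mult_left_mono[OF onorm[OF A.bounded_linear_axioms, of x], of "cmod c"]
      by (simp add: norm_scaleC mult_ac)
  qed (simp_all add: A.add A.scaleR scaleC_add_right,
      simp add: scaleR_scaleC scaleC_scaleC mult.commute)
  then show ?thesis
    using assms by (simp add: bounded_clinear_def scaleC_scaleC mult.commute)
qed

text \<open>Multiplying \<open>A\<close> by a unimodular \<open>c\<close> keeps the form bound and
  multiplies the form of the square by \<open>c * c\<close>. Half the angle that makes this form
  real and nonnegative therefore reduces the modulus to the real part.\<close>

lemma form_bound_square:
  assumes "bounded_clinear A" and "0 < w"
    and w: "\<And>x. cmod (cinner (A x) x) \<le> w * (norm x)\<^sup>2"
  shows "cmod (cinner (A (A x)) x) \<le> w\<^sup>2 * (norm x)\<^sup>2"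
proof -
  obtain \<theta> :: real
    where \<theta>: "exp (\<i> * of_real \<theta>) * cinner (A (A x)) x = of_real (cmod (cinner (A (A x)) x))"
    using ex_rotation by blast
  define c where "c = exp (\<i> * of_real (\<theta> / 2))"
  have c: "cmod c = 1" "c * c = exp (\<i> * of_real \<theta>)"
    by (simp_all add: c_def flip: exp_add)
  have "Re (cinner (c *\<^sub>C A (c *\<^sub>C A x)) x) \<le> w\<^sup>2 * (norm x)\<^sup>2"
    using form_bound_square_Re[OF scaleC_bounded_clinear[OF assms(1), of c] assms(2)] w c
    by (simp add: cinner_linear_simps norm_mult)
  moreover have "cinner (c *\<^sub>C A (c *\<^sub>C A x)) x = of_real (cmod (cinner (A (A x)) x))"
    using assms(1) \<theta> by (simp add: bounded_clinear_def cinner_linear_simps c(2) flip: mult.assoc)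
  ultimately show ?thesis
    by simp
qed

lemma bounded_clinear_square: "bounded_clinear A \<Longrightarrow> bounded_clinear (\<lambda>x. A (A x))"
  by (auto simp: bounded_clinear_def intro: bounded_linear_compose)

text \<open>Commutation gives \<open>norm (B y) = norm (A y)\<close>, so Cauchy-Schwarz applied to
  \<open>cinner x (B (A x))\<close> can be stated in terms of \<open>A\<close> alone.\<close>

lemma normal_norm_square:
  assumes adj: "\<And>x y. cinner (A x) y = cinner x (B y)" and comm: "\<And>x. A (B x) = B (A x)"
  shows "(norm (A x))\<^sup>2 \<le> norm (A (A x)) * norm x"
proof -
  have adj': "cinner (B x) y = cinner x (A y)" for x y
    by (metis adj cinner_commute)
  have "(norm (B y))\<^sup>2 = (norm (A y))\<^sup>2" for y
    by (metis Re_cinner_self adj adj' comm)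
  then have BA: "norm (B y) = norm (A y)" for y
    by (metis norm_ge_zero power2_eq_imp_eq)
  have "(norm (A x))\<^sup>2 = Re (cinner x (B (A x)))"
    by (simp add: adj flip: Re_cinner_self)
  also have "\<dots> \<le> norm x * norm (B (A x))"
    using complex_Re_le_cmod cinner_Cauchy_Schwarz order_trans by blast
  finally show ?thesis
    by (simp add: BA mult.commute)
qed

text \<open>The claim for \<open>n\<close>, applied to the square of \<open>A\<close> with bound
  \<open>w\<^sup>2\<close>, yields the claim for \<open>Suc n\<close> after a square root, which
  halves the exponent of 2. The adjoint enters as any \<open>B\<close> satisfying the adjoint
  relation, so the square of \<open>B\<close> serves for the square of \<open>A\<close>.\<close>

lemma normal_norm_le_root:
  assumes "bounded_clinear A" and "\<And>x y. cinner (A x) y = cinner x (B y)"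
    and "\<And>x. A (B x) = B (A x)" and "0 < w"
    and "\<And>x. cmod (cinner (A x) x) \<le> w * (norm x)\<^sup>2"
  shows "norm (A x) \<le> 2 powr (1 / 2 ^ n) * w * norm x"
  using assms
proof (induction n arbitrary: A B w x)
  case 0
  then show ?case
    using norm_le_twice_form_bound[of A w x] by simp
next
  case (Suc n)
  have "norm (A (A x)) \<le> 2 powr (1 / 2 ^ n) * w\<^sup>2 * norm x"
  proof (rule Suc.IH[where A = "\<lambda>x. A (A x)" and B = "\<lambda>x. B (B x)"])
    show "cmod (cinner (A (A x)) x) \<le> w\<^sup>2 * (norm x)\<^sup>2" for x
      using Suc.prems by (intro form_bound_square)
  qed (use Suc.prems in \<open>auto intro: bounded_clinear_square\<close>)
  then have "norm (A (A x)) * norm x \<le> 2 powr (1 / 2 ^ n) * w\<^sup>2 * norm x * norm x"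
    by (rule mult_right_mono) simp
  with normal_norm_square[of A B x] Suc.prems(2,3)
  have "(norm (A x))\<^sup>2 \<le> 2 powr (1 / 2 ^ n) * w\<^sup>2 * norm x * norm x"
    by fastforce
  also have "2 powr (1 / 2 ^ n) = (2 powr (1 / 2 ^ Suc n) :: real)\<^sup>2"
    by (simp add: power2_eq_square flip: powr_add)
  finally have "(norm (A x))\<^sup>2 \<le> (2 powr (1 / 2 ^ Suc n) * w * norm x)\<^sup>2"
    by (simp add: power2_eq_square mult_ac)
  then show ?case
    by (rule power2_le_imp_le) (use \<open>0 < w\<close> in simp)
qed

lemma normal_onorm_eq_numerical_radius:
  fixes A :: "'a::chilbert_space \<Rightarrow> 'a"
  assumes "normal_operator A"
  shows "onorm A = numerical_radius A"
proof (rule antisym)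
  have A: "bounded_clinear A" and comm: "A (cadjoint A x) = cadjoint A (A x)" for x
    using assms by (auto simp: normal_operator_def fun_eq_iff)
  have bl: "bounded_linear A"
    using A by (rule bounded_clinear_bounded_linear)
  show "numerical_radius A \<le> onorm A"
    using onorm_pos_le[OF bl] cmod_cinner_le_onorm[OF bl] by (rule numerical_radius_le)
  show "onorm A \<le> numerical_radius A"
  proof (rule field_le_epsilon)
    fix e :: real assume "0 < e"
    \<comment> \<open>The root estimate needs a strictly positive bound, whereas the numerical
      radius of the zero operator is 0.\<close>
    define w where "w = numerical_radius A + e"
    have w: "0 < w"
      using numerical_radius_nonneg[OF bl] \<open>0 < e\<close> by (simp add: w_def)
    have form: "cmod (cinner (A x) x) \<le> w * (norm x)\<^sup>2" for x
      using cmod_cinner_le_numerical_radius[OF bl, of x] \<open>0 < e\<close>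
      by (simp add: w_def distrib_right add_increasing2)
    have "norm (A x) \<le> w * norm x" for x
    proof (rule LIMSEQ_le_const)
      have "(\<lambda>n. 1 / 2 ^ n :: real) \<longlonglongrightarrow> 0"
        by (rule LIMSEQ_divide_realpow_zero) simp
      then have "(\<lambda>n. 2 powr (1 / 2 ^ n) * w * norm x) \<longlonglongrightarrow> 2 powr 0 * w * norm x"
        by (intro tendsto_intros) auto
      then show "(\<lambda>n. 2 powr (1 / 2 ^ n) * w * norm x) \<longlonglongrightarrow> w * norm x"
        by simp
      show "\<exists>N. \<forall>n\<ge>N. norm (A x) \<le> 2 powr (1 / 2 ^ n) * w * norm x"
        using normal_norm_le_root[OF A cinner_cadjoint[OF A] comm w form] by blast
    qed
    then show "onorm A \<le> numerical_radius A + e"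
      using w unfolding w_def[symmetric] by (intro onorm_bound) auto
  qed
qed

section \<open>The integral formula\<close>

lemma cmod_segment_cnj_le:
  assumes "0 \<le> t" "t \<le> 1"
  shows "cmod (of_real (1 - t) * z + of_real t * cnj z) \<le> cmod z"
proof -
  have "cmod (of_real (1 - t) * z + of_real t * cnj z) \<le> \<bar>1 - t\<bar> * cmod z + \<bar>t\<bar> * cmod z"
    by (rule norm_triangle_le) (simp add: norm_mult del: of_real_diff)
  also have "\<dots> = cmod z"
    using assms by (simp add: algebra_simps)
  finally show ?thesis .
qed

text \<open>Passing from \<open>s\<close> to \<open>t\<close> adds
  \<open>of_real (t - s) * (cnj z - z)\<close>. The Lipschitz constant is uniform where
  \<open>cmod z\<close> is bounded, so the estimate survives the supremum over unit vectors and
  makes the integrand continuous, hence integrable.\<close>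

lemma cmod_segment_cnj_lipschitz:
  "cmod (of_real (1 - t) * z + of_real t * cnj z)
    \<le> cmod (of_real (1 - s) * z + of_real s * cnj z) + 2 * cmod z * \<bar>t - s\<bar>"
proof -
  have "of_real (1 - t) * z + of_real t * cnj z
      = (of_real (1 - s) * z + of_real s * cnj z) + of_real (t - s) * (cnj z - z)"
    by (simp add: algebra_simps)
  moreover have "cmod (of_real (t - s) * (cnj z - z)) \<le> 2 * cmod z * \<bar>t - s\<bar>"
    using norm_triangle_ineq4[of "cnj z" z]
    by (simp add: norm_mult mult.commute mult_left_mono del: of_real_diff)
  ultimately show ?thesis
    by (simp only:) (rule order_trans[OF norm_triangle_ineq add_left_mono])
qed

lemma numerical_radius_eq_SUP_integral:
  fixes A :: "'a::chilbert_space \<Rightarrow> 'a"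
  assumes "bounded_clinear A"
  shows "numerical_radius A =
      (SUP \<theta>::real. integral {0..1} (\<lambda>t::real. numerical_radius
        (\<lambda>x. (complex_of_real (1 - t) * exp (\<i> * complex_of_real \<theta>)) *\<^sub>C A x
           + (complex_of_real t * exp (- \<i> * complex_of_real \<theta>)) *\<^sub>C cadjoint A x)))"
    (is "_ = (SUP \<theta>. integral _ (\<lambda>t. numerical_radius (?T \<theta> t)))")
proof -
  have bl: "bounded_linear A"
    using assms by (rule bounded_clinear_bounded_linear)
  define w where "w = numerical_radius A"
  define z where "z \<theta> x = exp (\<i> * complex_of_real \<theta>) * cinner (A x) x" for \<theta> x
  have w0: "0 \<le> w"
    using numerical_radius_nonneg[OF bl] by (simp add: w_def)
  have z_le: "cmod (z \<theta> x) \<le> w" if "norm x = 1" for \<theta> x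
    using numerical_radius_upper[OF bl that] by (simp add: z_def w_def norm_mult)
  have adj: "cinner (cadjoint A x) x = cnj (cinner (A x) x)" for x
    using cinner_cadjoint[OF assms, of x x] cinner_commute by metis
  have form: "cinner (?T \<theta> t x) x = of_real (1 - t) * z \<theta> x + of_real t * cnj (z \<theta> x)" for \<theta> t x
    by (simp add: cinner_linear_simps adj z_def exp_cnj mult.assoc)
  \<comment> \<open>The Lipschitz estimate against \<open>s = 0\<close> covers every real
    \<open>t\<close>, so the supremum facts below carry no restriction to the unit interval.\<close>
  have bounded: "cmod (cinner (?T \<theta> t x) x) \<le> w + 2 * w * \<bar>t\<bar>" if "norm x = 1" for \<theta> t x
    using cmod_segment_cnj_lipschitz[of t "z \<theta> x" 0] z_le[OF that, of \<theta>]
      mult_right_mono[of "2 * cmod (z \<theta> x)" "2 * w" "\<bar>t\<bar>"]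
    by (simp only: form) simp
  have upper: "cmod (cinner (?T \<theta> t x) x) \<le> numerical_radius (?T \<theta> t)" if "norm x = 1" for \<theta> t x
    by (rule numerical_radius_ge(1)[OF bounded that])
  have nonneg: "0 \<le> numerical_radius (?T \<theta> t)" for \<theta> t
    by (rule numerical_radius_ge(2)[OF bounded])
  have le: "numerical_radius (?T \<theta> t) \<le> w" if "t \<in> {0..1}" for \<theta> t
    using that unfolding atLeastAtMost_iff
    by (intro numerical_radius_le w0) (simp only: form, blast intro: order_trans[OF cmod_segment_cnj_le z_le])
  have lip: "numerical_radius (?T \<theta> t) \<le> numerical_radius (?T \<theta> s) + 2 * w * \<bar>t - s\<bar>" for \<theta> t s
  proof (rule numerical_radius_le)
    show "0 \<le> numerical_radius (?T \<theta> s) + 2 * w * \<bar>t - s\<bar>"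
      using nonneg[where \<theta> = \<theta> and t = s] w0 by simp
  next
    fix x :: 'a assume x: "norm x = 1"
    have "2 * cmod (z \<theta> x) * \<bar>t - s\<bar> \<le> 2 * w * \<bar>t - s\<bar>"
      using z_le[OF x, of \<theta>] by (intro mult_right_mono) auto
    then show "cmod (cinner (?T \<theta> t x) x) \<le> numerical_radius (?T \<theta> s) + 2 * w * \<bar>t - s\<bar>"
      using cmod_segment_cnj_lipschitz[of t "z \<theta> x" s] upper[OF x, where \<theta> = \<theta> and t = s]
      unfolding form by linarith
  qed
  have "continuous_on {0..1} (\<lambda>t. numerical_radius (?T \<theta> t))" for \<theta>
  proof (rule lipschitz_on_continuous_on[OF lipschitz_onI])
    show "dist (numerical_radius (?T \<theta> t)) (numerical_radius (?T \<theta> s)) \<le> 2 * w * dist t s" for t s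
      using lip[where \<theta> = \<theta> and t = t and s = s] lip[where \<theta> = \<theta> and t = s and s = t] 
      unfolding dist_real_def abs_le_iff abs_minus_commute[of s t] by argo
  qed (use w0 in simp)
  then have int: "(\<lambda>t. numerical_radius (?T \<theta> t)) integrable_on {0..1}" for \<theta>
    by (rule integrable_continuous_real)
  define I where "I \<theta> = integral {0..1} (\<lambda>t. numerical_radius (?T \<theta> t))" for \<theta>
  have I_le: "I \<theta> \<le> w" for \<theta>
    using integral_le[OF int integrable_const_ivl le] by (simp add: I_def)
  have I_ge: "c \<le> I \<theta>" if "\<And>t. t \<in> {0..1} \<Longrightarrow> c \<le> numerical_radius (?T \<theta> t)" for c \<theta>
    using integral_le[OF integrable_const_ivl int that] by (simp add: I_def)
  have bdd: "bdd_above (range I)"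
    using I_le by (intro bdd_aboveI[of _ w]) auto
  have "w \<le> (SUP \<theta>. I \<theta>)"
    unfolding w_def
  proof (rule numerical_radius_le)
    \<comment> \<open>Because 0 is inserted into the set defining \<open>numerical_radius\<close>,
      an upper bound must also be shown nonnegative; on the zero space this is the only
      condition.\<close>
    have "0 \<le> I 0"
      by (rule I_ge) (rule nonneg)
    then show "0 \<le> (SUP \<theta>. I \<theta>)"
      using cSUP_upper[OF UNIV_I bdd] by (rule order_trans)
  next
    fix x :: 'a assume x: "norm x = 1"
    \<comment> \<open>With \<open>z \<theta> x\<close> real, it equals its conjugate and the form of
      the integrand at \<open>x\<close> is constant in \<open>t\<close>; its integral over an
      interval of length 1 is that constant.\<close>
    obtain \<theta> where \<theta>: "z \<theta> x = of_real (cmod (cinner (A x) x))"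
      using ex_rotation[of "cinner (A x) x"] by (auto simp: z_def)
    have "cmod (cinner (A x) x) \<le> I \<theta>"
    proof (rule I_ge)
      fix t :: real
      have "cinner (?T \<theta> t x) x = of_real (cmod (cinner (A x) x))"
        unfolding form \<theta> by (simp add: algebra_simps)
      then show "cmod (cinner (A x) x) \<le> numerical_radius (?T \<theta> t)"
        using upper[OF x, where \<theta> = \<theta> and t = t] by simp
    qed
    then show "cmod (cinner (A x) x) \<le> (SUP \<theta>. I \<theta>)"
      using cSUP_upper[OF UNIV_I bdd] by (rule order_trans)
  qed
  moreover have "(SUP \<theta>. I \<theta>) \<le> w"
    using I_le by (intro cSUP_least) auto
  ultimately show ?thesis
    by (simp add: w_def I_def)
qed

theorem corollary2p3:
  fixes A :: "'a::chilbert_space \<Rightarrow> 'a"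
  assumes "bounded_clinear A"
  shows "numerical_radius A =
      (SUP \<theta>::real. integral {0..1} (\<lambda>t::real. numerical_radius
        (\<lambda>x. (complex_of_real (1 - t) * exp (\<i> * complex_of_real \<theta>)) *\<^sub>C A x
           + (complex_of_real t * exp (- \<i> * complex_of_real \<theta>)) *\<^sub>C cadjoint A x)))
    \<and> (normal_operator A \<longrightarrow> onorm A =
      (SUP \<theta>::real. integral {0..1} (\<lambda>t::real. numerical_radius
        (\<lambda>x. (complex_of_real (1 - t) * exp (\<i> * complex_of_real \<theta>)) *\<^sub>C A x
           + (complex_of_real t * exp (- \<i> * complex_of_real \<theta>)) *\<^sub>C cadjoint A x))))"
  using numerical_radius_eq_SUP_integral[OF assms] normal_onorm_eq_numerical_radius[of A] by simp

end
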